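(* There exists no inductive conditional pre-expectation transformer (CPET) for $\mathsf{cpGCL}^-$. That is, for a fixed initial state $\sigma_0$ there do not exist a set $D$, an interpretation function $\llbracket\cdot\rrbracket:D\to\mathbb R\cup\{\bot\}$, and a function $\mathsf{cwp}^*:\mathsf{cpGCL}^-\to D$ such that all of the following hold: (1) for every $P\in\mathsf{cpGCL}^-$, $\llbracket\mathsf{cwp}^*[P]\rrbracket=\mathsf{CExpRew}^{\mathfrak R_{\sigma_0}^{x}\llbracket P\rrbracket}(\lozenge\,sink\mid\neg\lozenge\,bad)$, the demonic (minimal) conditional expected value of $x$; (2) there is a function $\mathcal K:D\times[0,1]\times D\to D$ with $\mathsf{cwp}^*[\{P_1\}[p]\{P_2\}]=\mathcal K(\mathsf{cwp}^*[P_1],p,\mathsf{cwp}^*[P_2])$ for all $P_1,P_2\in\mathsf{cpGCL}^-$ and $p\in[0,1]$; (3) there is a function $\mathcal N:D\times D\to D$ with $\mathsf{cwp}^*[\{P_1\}\,\Box\,\{P_2\}]=\mathcal N(\mathsf{cwp}^*[P_1],\mathsf{cwp}^*[P_2])$ for all $P_1,P_2\in\mathsf{cpGCL}^-$, and $\mathcal N(d_1,d_2)\in\{d_1,d_2\}$ for all $d_1,d_2\in D$.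
   Context: **Programs.** There is a single program variable $x$, taking non-negative real values; a state $\sigma$ is a value of $x$. $\mathsf{cpGCL}^-$ is the set of programs generated by $$P::=x:=E\mid\mathtt{observe}\,G\mid\{P\}[p]\{P\}\mid\{P\}\,\Box\,\{P\},$$ where $E$ is an arithmetic expression (all non-negative rational constants are included), $G$ is a Boolean expression over $x$ (including $\mathtt{false}$), $p\in[0,1]$, $\{P\}[p]\{Q\}$ is probabilistic choice (left with probability $p$, right with probability $1-p$), and $\{P\}\,\Box\,\{Q\}$ is non-deterministic choice. **Operational model.** $\mathfrak R_{\sigma_0}^{x}\llbracket P\rrbracket$ is the reward Markov decision process with actions $left,right$, initial state $\langle P,\sigma_0\rangle$ and transitions (with probability 1, and only one enabled action, unless stated): $\langle x:=E,\sigma\rangle\to\langle\downarrow,\sigma[x\leftarrow E(\sigma)]\rangle$; $\langle\mathtt{observe}\,G,\sigma\rangle\to\langle\downarrow,\sigma\rangle$ if $\sigma\models G$ and $\to\langle bad\rangle$ otherwise; $\langle\{P\}[p]\{Q\},\sigma\rangle$ goes to $\langle P,\sigma\rangle$ with probability $p$ and $\langle Q,\sigma\rangle$ with probability $1-p$ (added if these coincide); in $\langle\{P\}\,\Box\,\{Q\},\sigma\rangle$ action $left$ leads to $\langle P,\sigma\rangle$ and action $right$ to $\langle Q,\sigma\rangle$; $\langle\downarrow,\sigma\rangle\to\langle sink\rangle$; $\langle bad\rangle\to\langle sink\rangle$; $\langle sink\rangle\to\langle sink\rangle$. The reward of $\langle\downarrow,\sigma\rangle$ is $\sigma(x)$;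 all other rewards are $0$. The reward of a finite path is the sum of the rewards of its states except the last. **Conditional expected reward.** A (deterministic, possibly history-dependent) scheduler $\mathfrak S$ maps finite paths to an enabled action of the last state and induces a Markov chain with path measure $\Pr^{\mathfrak S}$. Let $\mathsf{ExpRew}^{\mathfrak S}(\lozenge\,sink\cap\neg\lozenge\,bad)$ be the sum of $\Pr^{\mathfrak S}(\hat\pi)\,r(\hat\pi)$ over finite paths $\hat\pi$ from the initial state ending at their first visit to $\langle sink\rangle$ and never visiting $\langle bad\rangle$, and let $\Pr^{\mathfrak S}(\neg\lozenge\,bad)$ be the probability of never visiting $\langle bad\rangle$. Then $$\mathsf{CExpRew}^{\mathfrak R}(\lozenge\,sink\mid\neg\lozenge\,bad)=\inf_{\mathfrak S}\frac{\mathsf{ExpRew}^{\mathfrak S}(\lozenge\,sink\cap\neg\lozenge\,bad)}{\Pr^{\mathfrak S}(\neg\lozenge\,bad)},$$ where the undefined quotient $\frac00$ is regarded as smaller than $0$ (so the value is undefined, written $\bot$, if some scheduler yields $\frac00$). *)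

theory Defs
  imports "HOL-Probability.Probability"
begin

section \<open>Reward Markov decision processes\<close>

record ('s, 'a) rmdp =
  init :: 's
  enabled :: "'s \<Rightarrow> 'a set"
  trans_pmf :: "'s \<Rightarrow> 'a \<Rightarrow> 's pmf"
  reward :: "'s \<Rightarrow> real"

definition edge :: "('s, 'a) rmdp \<Rightarrow> 's \<Rightarrow> 's \<Rightarrow> bool" where
  "edge R s t \<longleftrightarrow> (\<exists>a \<in> enabled R s. pmf (trans_pmf R s a) t > 0)"

definition fin_paths :: "('s, 'a) rmdp \<Rightarrow> 's list set" where
  "fin_paths R = {\<pi>. \<pi> \<noteq> [] \<and> hd \<pi> = init R \<and>
     (\<forall>i. Suc i < length \<pi> \<longrightarrow> edge R (\<pi> ! i) (\<pi> ! Suc i))}"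

definition inf_paths :: "('s, 'a) rmdp \<Rightarrow> (nat \<Rightarrow> 's) set" where
  "inf_paths R = {\<omega>. \<omega> 0 = init R \<and> (\<forall>i. edge R (\<omega> i) (\<omega> (Suc i)))}"

definition schedulers :: "('s, 'a) rmdp \<Rightarrow> ('s list \<Rightarrow> 'a) set" where
  "schedulers R = {S. \<forall>\<pi> \<in> fin_paths R. S \<pi> \<in> enabled R (last \<pi>)}"

definition path_prob :: "('s, 'a) rmdp \<Rightarrow> ('s list \<Rightarrow> 'a) \<Rightarrow> 's list \<Rightarrow> real" where
  "path_prob R S \<pi> =
     (\<Prod>i < length \<pi> - 1. pmf (trans_pmf R (\<pi> ! i) (S (take (Suc i) \<pi>))) (\<pi> ! Suc i))"

definition path_reward :: "('s, 'a) rmdp \<Rightarrow> 's list \<Rightarrow> real" where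
  "path_reward R \<pi> = sum_list (map (reward R) (butlast \<pi>))"

definition cylinder :: "('s, 'a) rmdp \<Rightarrow> 's list \<Rightarrow> (nat \<Rightarrow> 's) set" where
  "cylinder R \<pi> = {\<omega> \<in> inf_paths R. \<forall>i < length \<pi>. \<omega> i = \<pi> ! i}"

text \<open>The path measure of the Markov chain induced by a scheduler: the measure on the
  \<open>\<sigma>\<close>-algebra generated by the cylinder sets that gives the cylinder of each finite path
  the probability of that path.\<close>

definition path_measure :: "('s, 'a) rmdp \<Rightarrow> ('s list \<Rightarrow> 'a) \<Rightarrow> (nat \<Rightarrow> 's) measure" where
  "path_measure R S =
     extend_measure (inf_paths R) (fin_paths R) (cylinder R) (\<lambda>\<pi>. ennreal (path_prob R S \<pi>))"

text \<open>\<open>T\<close> is the set of target states, \<open>B\<close> the set of states to be avoided.\<close>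

definition prob_avoid :: "('s, 'a) rmdp \<Rightarrow> ('s list \<Rightarrow> 'a) \<Rightarrow> 's set \<Rightarrow> real" where
  "prob_avoid R S B = measure (path_measure R S) {\<omega> \<in> inf_paths R. \<forall>i. \<omega> i \<notin> B}"

definition exp_rew :: "('s, 'a) rmdp \<Rightarrow> ('s list \<Rightarrow> 'a) \<Rightarrow> 's set \<Rightarrow> 's set \<Rightarrow> real" where
  "exp_rew R S T B =
     (\<Sum>\<^sub>\<infinity>\<pi> \<in> {\<pi> \<in> fin_paths R. last \<pi> \<in> T \<and> set (butlast \<pi>) \<inter> T = {} \<and> set \<pi> \<inter> B = {}}.
        path_prob R S \<pi> * path_reward R \<pi>)"

text \<open>\<open>None\<close> stands for \<open>\<bottom>\<close>, the undefined quotient \<open>0/0\<close>. The quotient \<open>x/0\<close> with \<open>x \<noteq> 0\<close>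
  does not arise below, since the paths counted in \<open>exp_rew\<close> to the target \<open>sink\<close>
  make up a part of the event measured by \<open>prob_avoid\<close>.\<close>

definition quotient :: "real \<Rightarrow> real \<Rightarrow> real option" where
  "quotient x y = (if x = 0 \<and> y = 0 then None else Some (x / y))"

text \<open>Infimum with respect to the order in which \<open>\<bottom>\<close> is smaller than every number.\<close>

definition Inf_bot :: "real option set \<Rightarrow> real option" where
  "Inf_bot A = (if None \<in> A then None else Some (Inf {x. Some x \<in> A}))"

definition cexp_rew :: "('s, 'a) rmdp \<Rightarrow> 's set \<Rightarrow> 's set \<Rightarrow> real option" where
  "cexp_rew R T B = Inf_bot ((\<lambda>S. quotient (exp_rew R S T B) (prob_avoid R S B)) ` schedulers R)"


section \<open>Programs and their operational model\<close>

typedef nonneg_real = "{x :: real. 0 \<le> x}" morphisms real_of_nonneg Abs_nonneg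
  by auto

typedef unit_real = "{0 .. 1 :: real}" morphisms real_of_unit Abs_unit
  by auto

text \<open>The languages of arithmetic expressions \<open>'e\<close> and of guards \<open>'g\<close> are parameters, given
  together with their semantics \<open>aval\<close> and \<open>bval\<close>. As there is only one variable, a
  state is its value, and assigning \<open>E\<close> in state \<open>\<sigma>\<close> yields the state \<open>aval E \<sigma>\<close>.\<close>

datatype ('e, 'g) prog =
    Assign 'e
  | Observe 'g
  | PChoice "('e, 'g) prog" unit_real "('e, 'g) prog"
  | NChoice "('e, 'g) prog" "('e, 'g) prog"

datatype ('e, 'g) config =
    Run "('e, 'g) prog" nonneg_real
  | Term nonneg_real
  | Bad
  | Sink

datatype action = GoLeft | GoRight

fun prog_enabled :: "('e, 'g) config \<Rightarrow> action set" where
  "prog_enabled (Run (NChoice P Q) \<sigma>) = {GoLeft, GoRight}"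
| "prog_enabled _ = {GoLeft}"

fun prog_trans ::
  "('e \<Rightarrow> nonneg_real \<Rightarrow> nonneg_real) \<Rightarrow> ('g \<Rightarrow> nonneg_real \<Rightarrow> bool) \<Rightarrow>
   ('e, 'g) config \<Rightarrow> action \<Rightarrow> ('e, 'g) config pmf" where
  "prog_trans aval bval (Run (Assign E) \<sigma>) a = return_pmf (Term (aval E \<sigma>))"
| "prog_trans aval bval (Run (Observe G) \<sigma>) a = return_pmf (if bval G \<sigma> then Term \<sigma> else Bad)"
| "prog_trans aval bval (Run (PChoice P p Q) \<sigma>) a =
     map_pmf (\<lambda>b. if b then Run P \<sigma> else Run Q \<sigma>) (bernoulli_pmf (real_of_unit p))"
| "prog_trans aval bval (Run (NChoice P Q) \<sigma>) a =
     return_pmf (case a of GoLeft \<Rightarrow> Run P \<sigma> | GoRight \<Rightarrow> Run Q \<sigma>)"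
| "prog_trans aval bval (Term \<sigma>) a = return_pmf Sink"
| "prog_trans aval bval Bad a = return_pmf Sink"
| "prog_trans aval bval Sink a = return_pmf Sink"

fun prog_reward :: "('e, 'g) config \<Rightarrow> real" where
  "prog_reward (Term \<sigma>) = real_of_nonneg \<sigma>"
| "prog_reward _ = 0"

definition prog_rmdp ::
  "('e \<Rightarrow> nonneg_real \<Rightarrow> nonneg_real) \<Rightarrow> ('g \<Rightarrow> nonneg_real \<Rightarrow> bool) \<Rightarrow>
   nonneg_real \<Rightarrow> ('e, 'g) prog \<Rightarrow> (('e, 'g) config, action) rmdp" where
  "prog_rmdp aval bval \<sigma>\<^sub>0 P =
     \<lparr>init = Run P \<sigma>\<^sub>0, enabled = prog_enabled, trans_pmf = prog_trans aval bval, reward = prog_reward\<rparr>"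


section \<open>Inductive conditional pre-expectation transformers\<close>

definition inductive_CPET ::
  "('e \<Rightarrow> nonneg_real \<Rightarrow> nonneg_real) \<Rightarrow> ('g \<Rightarrow> nonneg_real \<Rightarrow> bool) \<Rightarrow> nonneg_real \<Rightarrow>
   'd set \<Rightarrow> ('d \<Rightarrow> real option) \<Rightarrow> (('e, 'g) prog \<Rightarrow> 'd) \<Rightarrow> bool" where
  "inductive_CPET aval bval \<sigma>\<^sub>0 D interp cwp \<longleftrightarrow>
     (\<forall>P. cwp P \<in> D) \<and>
     (\<forall>P. interp (cwp P) = cexp_rew (prog_rmdp aval bval \<sigma>\<^sub>0 P) {Sink} {Bad}) \<and>
     (\<exists>K. (\<forall>d\<^sub>1\<in>D. \<forall>p. \<forall>d\<^sub>2\<in>D. K d\<^sub>1 p d\<^sub>2 \<in> D) \<and>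
          (\<forall>P\<^sub>1 p P\<^sub>2. cwp (PChoice P\<^sub>1 p P\<^sub>2) = K (cwp P\<^sub>1) p (cwp P\<^sub>2))) \<and>
     (\<exists>N. (\<forall>d\<^sub>1\<in>D. \<forall>d\<^sub>2\<in>D. N d\<^sub>1 d\<^sub>2 \<in> {d\<^sub>1, d\<^sub>2}) \<and>
          (\<forall>P\<^sub>1 P\<^sub>2. cwp (NChoice P\<^sub>1 P\<^sub>2) = N (cwp P\<^sub>1) (cwp P\<^sub>2)))"

end

theory Submission
  imports Defs
begin

text \<open>A locally optimal non-deterministic choice need not be optimal in a probabilistic context.
  With \<open>B\<close> being \<open>x := 4\<close> and \<open>C\<close> being \<open>{observe false} [1/2] {x := 5}\<close>, the conditional values
  are 4 and 5, and that of \<open>B \<box> C\<close> is 4, so a transformer has to identify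
  \<open>B \<box> C\<close> with \<open>B\<close>. But mixing with \<open>x := 0\<close> with probability 1/2 gives 2 for \<open>B\<close> and only
  \<open>(5/4)/(3/4) = 5/3\<close> for \<open>C\<close>, because half of the runs of \<open>C\<close> are conditioned away.

  Both quantities in the quotient are computed as expectations over the finitely many runs up to
  the sink; padding these runs with the sink yields the measure on infinite paths whose existence
  makes the values of the path measure on cylinders meaningful.\<close>

section \<open>Paths up to the first visit to the sink, and their padding\<close>

fun first_sink :: "('e, 'g) config list \<Rightarrow> bool" where
  "first_sink [] \<longleftrightarrow> False"
| "first_sink (c # \<rho>) \<longleftrightarrow> (if c = Sink then \<rho> = [] else first_sink \<rho>)"

text \<open>Ties the recursive form, made for induction along a path, to the condition on target
  paths in \<open>exp_rew\<close>.\<close>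

lemma first_sink_iff:
  "first_sink \<rho> \<longleftrightarrow> \<rho> \<noteq> [] \<and> last \<rho> = Sink \<and> Sink \<notin> set (butlast \<rho>)"
  by (induction \<rho>) auto

definition pad :: "('e, 'g) config list \<Rightarrow> nat \<Rightarrow> ('e, 'g) config" where
  "pad \<rho> i = (if i < length \<rho> then \<rho> ! i else Sink)"

lemma pad_Nil [simp]: "pad [] = (\<lambda>_. Sink)"
  by (simp add: pad_def fun_eq_iff)

lemma pad_Cons_0 [simp]: "pad (c # \<rho>) 0 = c"
  by (simp add: pad_def)

lemma pad_Cons_Suc [simp]: "pad (c # \<rho>) (Suc i) = pad \<rho> i"
  by (simp add: pad_def)

text \<open>The condition of \<open>cylinder\<close> freed from membership in
  \<open>inf_paths\<close>, so that it passes to tails, which start in other configurations.\<close>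

definition follows :: "(nat \<Rightarrow> 's) \<Rightarrow> 's list \<Rightarrow> bool" where
  "follows \<omega> \<pi> \<longleftrightarrow> (\<forall>i < length \<pi>. \<omega> i = \<pi> ! i)"

lemma follows_Nil [simp]: "follows \<omega> []"
  by (simp add: follows_def)

lemma follows_Cons [simp]: "follows \<omega> (c # \<pi>) \<longleftrightarrow> \<omega> 0 = c \<and> follows (\<lambda>i. \<omega> (Suc i)) \<pi>"
  by (auto simp: follows_def All_less_Suc2)

lemma follows_pad: "follows (pad \<rho>) \<rho>"
  by (simp add: follows_def pad_def)

lemma pad_Sink [simp]: "pad [Sink] = (\<lambda>_. Sink)"
  by (simp add: pad_def fun_eq_iff)

text \<open>Both lists end at the first index where \<open>\<omega>\<close> is \<open>Sink\<close>,
  so they have the same length.\<close>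

lemma first_sink_unique:
  assumes "first_sink \<rho>" "first_sink \<rho>'" "follows \<omega> \<rho>" "follows \<omega> \<rho>'"
  shows "\<rho> = \<rho>'"
  using assms
proof (induction \<rho> arbitrary: \<rho>' \<omega>)
  case (Cons c \<rho>)
  from Cons.prems obtain \<rho>'' where \<rho>': "\<rho>' = c # \<rho>''"
    by (cases \<rho>') auto
  show ?case
    using Cons.prems Cons.IH[of \<rho>'' "\<lambda>i. \<omega> (Suc i)"] by (auto simp: \<rho>' split: if_splits)
qed simp

lemma ex_action: "(\<exists>a. Q a) \<longleftrightarrow> Q GoLeft \<or> Q GoRight"
  by (metis action.exhaust)

section \<open>Transition graph of the operational model\<close>

context
  fixes aval :: "'e \<Rightarrow> nonneg_real \<Rightarrow> nonneg_real"
    and bval :: "'g \<Rightarrow> nonneg_real \<Rightarrow> bool"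
begin

abbreviation trans where "trans \<equiv> prog_trans aval bval"

abbreviation model where "model \<equiv> prog_rmdp aval bval"

definition step :: "('e, 'g) config \<Rightarrow> ('e, 'g) config \<Rightarrow> bool" where
  "step s t \<longleftrightarrow> (\<exists>a. pmf (trans s a) t > 0)"

text \<open>An action that is not enabled is interpreted by the transition function like an enabled one.\<close>

lemma edge_model: "edge (model \<sigma>\<^sub>0 P\<^sub>0) = step"
proof (intro ext)
  fix s t :: "('e, 'g) config"
  have "(\<exists>a \<in> prog_enabled s. pmf (trans s a) t > 0) \<longleftrightarrow> (\<exists>a. pmf (trans s a) t > 0)"
  proof (cases s)
    case (Run P \<sigma>)
    then show ?thesis by (cases P) (auto simp: ex_action)
  qed auto
  then show "edge (model \<sigma>\<^sub>0 P\<^sub>0) s t = step s t"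
    by (simp add: edge_def step_def prog_rmdp_def)
qed

lemma step_iff_set_pmf: "step s t \<longleftrightarrow> (\<exists>a. t \<in> set_pmf (trans s a))"
  by (auto simp: step_def set_pmf_iff order_less_le)

lemma step_Run_Assign [simp]: "step (Run (Assign E) \<sigma>) t \<longleftrightarrow> t = Term (aval E \<sigma>)"
  and step_Run_Observe [simp]:
    "step (Run (Observe G) \<sigma>) t \<longleftrightarrow> t = (if bval G \<sigma> then Term \<sigma> else Bad)"
  and step_Run_NChoice [simp]: "step (Run (NChoice P Q) \<sigma>) t \<longleftrightarrow> t = Run P \<sigma> \<or> t = Run Q \<sigma>"
  and step_Term [simp]: "step (Term \<sigma>) t \<longleftrightarrow> t = Sink"
  and step_Bad [simp]: "step Bad t \<longleftrightarrow> t = Sink"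
  and step_Sink [simp]: "step Sink t \<longleftrightarrow> t = Sink"
  by (auto simp: step_iff_set_pmf ex_action)

text \<open>An implication only: if \<open>p\<close> is 0 or 1, one branch may fail to be a
  successor.\<close>

lemma step_Run_PChoiceD: "step (Run (PChoice P p Q) \<sigma>) t \<Longrightarrow> t = Run P \<sigma> \<or> t = Run Q \<sigma>"
  by (auto simp: step_iff_set_pmf split: if_splits)

definition steps :: "(nat \<Rightarrow> ('e, 'g) config) \<Rightarrow> bool" where
  "steps \<omega> \<longleftrightarrow> (\<forall>i. step (\<omega> i) (\<omega> (Suc i)))"

lemma steps_unfold: "steps \<omega> \<longleftrightarrow> step (\<omega> 0) (\<omega> (Suc 0)) \<and> steps (\<lambda>i. \<omega> (Suc i))"
  unfolding steps_def by (metis not0_implies_Suc)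

lemma inf_paths_model: "inf_paths (model \<sigma>\<^sub>0 P) = {\<omega>. \<omega> 0 = Run P \<sigma>\<^sub>0 \<and> steps \<omega>}"
  by (simp add: inf_paths_def edge_model steps_def) (simp add: prog_rmdp_def)

lemma fin_paths_model:
  "fin_paths (model \<sigma>\<^sub>0 P) = {\<pi>. \<pi> \<noteq> [] \<and> hd \<pi> = Run P \<sigma>\<^sub>0 \<and>
     (\<forall>i. Suc i < length \<pi> \<longrightarrow> step (\<pi> ! i) (\<pi> ! Suc i))}"
  by (simp add: fin_paths_def edge_model) (simp add: prog_rmdp_def)

lemma cylinder_model:
  "cylinder (model \<sigma>\<^sub>0 P) \<pi> = {\<omega> \<in> inf_paths (model \<sigma>\<^sub>0 P). follows \<omega> \<pi>}"
  by (simp add: cylinder_def follows_def)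

section \<open>The finitely many runs up to the sink and their distribution\<close>

primrec sink_paths :: "nonneg_real \<Rightarrow> ('e, 'g) prog \<Rightarrow> ('e, 'g) config list set" where
  "sink_paths \<sigma> (Assign E) = {[Run (Assign E) \<sigma>, Term (aval E \<sigma>), Sink]}"
| "sink_paths \<sigma> (Observe G) = {[Run (Observe G) \<sigma>, if bval G \<sigma> then Term \<sigma> else Bad, Sink]}"
| "sink_paths \<sigma> (PChoice P p Q) =
     (#) (Run (PChoice P p Q) \<sigma>) ` (sink_paths \<sigma> P \<union> sink_paths \<sigma> Q)"
| "sink_paths \<sigma> (NChoice P Q) =
     (#) (Run (NChoice P Q) \<sigma>) ` (sink_paths \<sigma> P \<union> sink_paths \<sigma> Q)"

lemma finite_sink_paths [simp]: "finite (sink_paths \<sigma> P)"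
  by (induction P) auto

lemma first_sink_sink_paths: "\<rho> \<in> sink_paths \<sigma> P \<Longrightarrow> first_sink \<rho>"
  by (induction P arbitrary: \<rho>) auto

text \<open>Programs have no loops, so structural induction suffices: the tail of an infinite path
  starts in an immediate subprogram, or the program is atomic and \<open>Sink\<close> comes two
  steps later.\<close>

lemma sink_paths_cover:
  assumes "\<omega> 0 = Run P \<sigma>" "steps \<omega>"
  shows "\<exists>\<rho> \<in> sink_paths \<sigma> P. follows \<omega> \<rho>"
  using assms
proof (induction P arbitrary: \<omega>)
  case (Assign E)
  then show ?case
    \<comment> \<open>The first unfolding exposes the step to \<open>Term\<close>, the second the
      step to \<open>Sink\<close>.\<close>
    by (subst (asm) steps_unfold, subst (asm) steps_unfold) auto
next
  case (Observe G)
  then show ?case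
    by (subst (asm) steps_unfold, subst (asm) steps_unfold) (auto split: if_splits)
next
  case (PChoice P p Q)
  have *: "\<omega> (Suc 0) = Run P \<sigma> \<or> \<omega> (Suc 0) = Run Q \<sigma>" "steps (\<lambda>i. \<omega> (Suc i))"
    using PChoice.prems steps_unfold step_Run_PChoiceD by metis+
  then show ?case
    using PChoice.IH[of "\<lambda>i. \<omega> (Suc i)"] PChoice.prems(1) by auto
next
  case (NChoice P Q)
  have *: "\<omega> (Suc 0) = Run P \<sigma> \<or> \<omega> (Suc 0) = Run Q \<sigma>" "steps (\<lambda>i. \<omega> (Suc i))"
    using NChoice.prems steps_unfold step_Run_NChoice by metis+
  then show ?case
    using NChoice.IH[of "\<lambda>i. \<omega> (Suc i)"] NChoice.prems(1) by auto
qed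

text \<open>\<open>h\<close> is the history before the current configuration, which the scheduler \<open>S\<close> may inspect.\<close>

primrec run ::
  "(('e, 'g) config list \<Rightarrow> action) \<Rightarrow> nonneg_real \<Rightarrow> ('e, 'g) prog \<Rightarrow> ('e, 'g) config list \<Rightarrow>
   ('e, 'g) config list pmf" where
  "run S \<sigma> (Assign E) h = return_pmf [Run (Assign E) \<sigma>, Term (aval E \<sigma>), Sink]"
| "run S \<sigma> (Observe G) h =
     return_pmf [Run (Observe G) \<sigma>, if bval G \<sigma> then Term \<sigma> else Bad, Sink]"
| "run S \<sigma> (PChoice P p Q) h =
     map_pmf ((#) (Run (PChoice P p Q) \<sigma>))
       (bernoulli_pmf (real_of_unit p) \<bind>
         (\<lambda>b. if b then run S \<sigma> P (h @ [Run (PChoice P p Q) \<sigma>])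
              else run S \<sigma> Q (h @ [Run (PChoice P p Q) \<sigma>])))"
| "run S \<sigma> (NChoice P Q) h =
     map_pmf ((#) (Run (NChoice P Q) \<sigma>))
       (case S (h @ [Run (NChoice P Q) \<sigma>]) of
          GoLeft \<Rightarrow> run S \<sigma> P (h @ [Run (NChoice P Q) \<sigma>])
        | GoRight \<Rightarrow> run S \<sigma> Q (h @ [Run (NChoice P Q) \<sigma>]))"

lemma set_run_subset: "set_pmf (run S \<sigma> P h) \<subseteq> sink_paths \<sigma> P"
proof (induction P arbitrary: h)
  case (PChoice P p Q)
  then show ?case by (fastforce split: if_splits)
next
  case (NChoice P Q)
  then show ?case by (fastforce split: action.splits)
qed auto

lemma finite_set_run [simp]: "finite (set_pmf (run S \<sigma> P h))"
  using set_run_subset finite_sink_paths by (rule finite_subset)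

abbreviation expect_run where
  "expect_run S \<sigma> P h g \<equiv> measure_pmf.expectation (run S \<sigma> P h) (g :: _ \<Rightarrow> real)"

text \<open>Total expectation over the coin flip, with the head configuration absorbed into
  \<open>g\<close>.\<close>

lemma expect_run_PChoice:
  fixes h p P Q \<sigma>
  defines "c \<equiv> Run (PChoice P p Q) \<sigma>"
  shows "expect_run S \<sigma> (PChoice P p Q) h g =
    real_of_unit p * expect_run S \<sigma> P (h @ [c]) (\<lambda>\<rho>. g (c # \<rho>)) +
    (1 - real_of_unit p) * expect_run S \<sigma> Q (h @ [c]) (\<lambda>\<rho>. g (c # \<rho>))"
proof -
  have p: "0 \<le> real_of_unit p" "real_of_unit p \<le> 1"
    using real_of_unit[of p] by auto
  show ?thesis
    unfolding run.simps c_def[symmetric] integral_map_pmf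
    by (subst pmf_expectation_bind[where A = UNIV]) (use p in \<open>auto simp: UNIV_bool\<close>)
qed


lemma steps_pad_Cons: "steps (pad (c # \<rho>)) \<longleftrightarrow> step c (pad \<rho> 0) \<and> steps (pad \<rho>)"
  by (subst steps_unfold) simp

lemma steps_Sink: "steps (\<lambda>_. Sink)"
  by (simp add: steps_def)

lemma run_pad_steps:
  assumes "\<rho> \<in> set_pmf (run S \<sigma> P h)"
  shows "pad \<rho> 0 = Run P \<sigma>" "steps (pad \<rho>)"
proof -
  have "pad \<rho> 0 = Run P \<sigma> \<and> steps (pad \<rho>)"
    using assms
  proof (induction P arbitrary: \<rho> h)
    case (PChoice P p Q)
    then obtain b \<rho>' where b: "b \<in> set_pmf (bernoulli_pmf (real_of_unit p))"
      and \<rho>': "\<rho> = Run (PChoice P p Q) \<sigma> # \<rho>'"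
        "\<rho>' \<in> set_pmf (run S \<sigma> (if b then P else Q) (h @ [Run (PChoice P p Q) \<sigma>]))"
      by (auto split: if_splits)
    \<comment> \<open>A sampled branch has positive probability, hence is a genuine edge even if
      \<open>p\<close> is 0 or 1.\<close>
    have "step (Run (PChoice P p Q) \<sigma>) (if b then Run P \<sigma> else Run Q \<sigma>)"
      using b by (auto simp: step_iff_set_pmf)
    then show ?case
      using PChoice.IH \<rho>'(2) unfolding \<rho>'(1) steps_pad_Cons by (auto split: if_splits)
  next
    case (NChoice P Q)
    then show ?case
      by (auto simp: steps_pad_Cons split: action.splits)
  qed (auto simp: steps_pad_Cons steps_Sink)
  then show "pad \<rho> 0 = Run P \<sigma>" "steps (pad \<rho>)" by auto
qed

section \<open>Path probabilities as probabilities of cylinders of padded runs\<close>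

fun prob_from ::
  "(('e, 'g) config list \<Rightarrow> action) \<Rightarrow> ('e, 'g) config list \<Rightarrow> ('e, 'g) config list \<Rightarrow> real" where
  "prob_from S h (c # d # \<pi>) =
     pmf (trans c (S (h @ [c]))) d * prob_from S (h @ [c]) (d # \<pi>)"
| "prob_from S h _ = 1"

text \<open>The recursion hands the history on in \<open>h\<close>, as \<open>run\<close> does; for
  empty \<open>h\<close> the product is that of \<open>path_prob\<close>.\<close>

lemma prob_from_eq:
  "prob_from S h \<pi> =
     (\<Prod>i < length \<pi> - 1. pmf (trans (\<pi> ! i) (S (h @ take (Suc i) \<pi>))) (\<pi> ! Suc i))"
  by (induction S h \<pi> rule: prob_from.induct)
     (simp_all add: prod.lessThan_Suc_shift del: prod.lessThan_Suc)

lemma path_prob_model: "path_prob (model \<sigma>\<^sub>0 P) S \<pi> = prob_from S [] \<pi>"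
  by (simp add: path_prob_def prob_from_eq) (simp add: prog_rmdp_def)

lemma prob_from_Sink: "prob_from S h (Sink # \<pi>) = of_bool (follows (\<lambda>_. Sink) \<pi>)"
  by (induction \<pi> arbitrary: h) (auto simp: indicator_def)

lemma prob_from_Term: "prob_from S h (Term \<sigma> # \<pi>) = of_bool (follows (\<lambda>_. Sink) \<pi>)"
  by (cases \<pi>) (auto simp: prob_from_Sink indicator_def)

lemma prob_from_Bad: "prob_from S h (Bad # \<pi>) = of_bool (follows (\<lambda>_. Sink) \<pi>)"
  by (cases \<pi>) (auto simp: prob_from_Sink indicator_def)

text \<open>If \<open>P\<close> and \<open>Q\<close> coincide, both summands count and the weights
  add up to 1.\<close>

lemma pmf_trans_PChoice:
  "pmf (trans (Run (PChoice P p Q) \<sigma>) a) t =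
     real_of_unit p * of_bool (t = Run P \<sigma>) + (1 - real_of_unit p) * of_bool (t = Run Q \<sigma>)"
proof -
  have p: "0 \<le> real_of_unit p" "real_of_unit p \<le> 1"
    using real_of_unit[of p] by auto
  show ?thesis
    by (simp only: prog_trans.simps map_pmf_def pmf_bind,
        subst integral_measure_pmf[where A = UNIV])
       (use p in \<open>auto simp: UNIV_bool indicator_def\<close>)
qed

text \<open>Each induction step peels the head off both the run and the path. With \<open>c\<close>
  arbitrary and value 0 for a wrong start, the hypotheses for both branches apply to the same
  remaining path.\<close>

lemma expect_run_follows:
  "expect_run S \<sigma> P h (\<lambda>\<rho>. of_bool (follows (pad \<rho>) (c # \<pi>))) =
     (if c = Run P \<sigma> then prob_from S h (c # \<pi>) else 0)"
proof (induction P arbitrary: h c \<pi>)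
  case (Assign E)
  show ?case by (cases \<pi>) (auto simp: prob_from_Term indicator_def)
next
  case (Observe G)
  show ?case by (cases \<pi>) (auto simp: prob_from_Term prob_from_Bad indicator_def)
next
  case (PChoice P p Q)
  show ?case
    using PChoice.IH
    by (cases \<pi>) (auto simp: expect_run_PChoice pmf_trans_PChoice algebra_simps simp del: run.simps prog_trans.simps)
next
  case (NChoice P Q)
  show ?case
    using NChoice.IH
    by (cases \<pi>) (auto split: action.splits)
qed

section \<open>Sums over paths to the sink as expectations over runs\<close>

lemma expect_run_eq_sum:
  "expect_run S \<sigma> P h g = (\<Sum>\<rho> \<in> sink_paths \<sigma> P. pmf (run S \<sigma> P h) \<rho> * g \<rho>)"
  by (subst integral_measure_pmf[where A = "sink_paths \<sigma> P"]) (use set_run_subset in \<open>auto simp: subset_iff\<close>)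

lemma pad_run_in_inf_paths:
  "\<rho> \<in> set_pmf (run S \<sigma> P h) \<Longrightarrow> pad \<rho> \<in> inf_paths (model \<sigma> P)"
  using run_pad_steps by (auto simp: inf_paths_model)

lemma prob_follows_run:
  assumes "\<pi> \<noteq> []" "hd \<pi> = Run P \<sigma>"
  shows "measure_pmf.prob (run S \<sigma> P []) {\<rho>. follows (pad \<rho>) \<pi>} = path_prob (model \<sigma> P) S \<pi>"
proof -
  obtain \<pi>' where \<pi>: "\<pi> = Run P \<sigma> # \<pi>'" using assms by (cases \<pi>) auto
  have "(\<lambda>\<rho>. of_bool (follows (pad \<rho>) \<pi>) :: real) = indicator {\<rho>. follows (pad \<rho>) \<pi>}"
    by (auto simp: indicator_def)
  then have "measure_pmf.prob (run S \<sigma> P []) {\<rho>. follows (pad \<rho>) \<pi>} =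
      expect_run S \<sigma> P [] (\<lambda>\<rho>. of_bool (follows (pad \<rho>) \<pi>))"
    by simp
  also have "\<dots> = path_prob (model \<sigma> P) S \<pi>"
    unfolding \<pi> expect_run_follows by (simp add: path_prob_model)
  finally show ?thesis .
qed

text \<open>Among runs, following a path that ends at its first \<open>Sink\<close> means being that
  path, so the cylinder probability is a point mass.\<close>

lemma path_prob_sink_path:
  assumes "\<pi> \<in> sink_paths \<sigma> P" "hd \<pi> = Run P \<sigma>"
  shows "path_prob (model \<sigma> P) S \<pi> = pmf (run S \<sigma> P []) \<pi>"
proof -
  have \<pi>: "first_sink \<pi>" using assms first_sink_sink_paths by blast
  have "path_prob (model \<sigma> P) S \<pi> = measure_pmf.prob (run S \<sigma> P []) {\<rho>. follows (pad \<rho>) \<pi>}"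
    by (rule prob_follows_run[symmetric]) (use assms \<pi> in auto)
  also have "\<dots> = measure_pmf.prob (run S \<sigma> P []) {\<pi>}"
  proof (intro measure_pmf.finite_measure_eq_AE)
    have "follows (pad \<rho>) \<pi> \<longleftrightarrow> \<rho> = \<pi>" if "\<rho> \<in> set_pmf (run S \<sigma> P [])" for \<rho>
    proof -
      have "first_sink \<rho>" using that set_run_subset first_sink_sink_paths by blast
      then show ?thesis using first_sink_unique[OF _ \<pi> follows_pad] follows_pad by blast
    qed
    then show "AE \<rho> in run S \<sigma> P []. \<rho> \<in> {\<rho>. follows (pad \<rho>) \<pi>} \<longleftrightarrow> \<rho> \<in> {\<pi>}"
      by (simp add: AE_measure_pmf_iff)
  qed auto
  finally show ?thesis by (simp add: pmf.rep_eq)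
qed

text \<open>Padding only adds the self-loop of \<open>Sink\<close>, which is always an edge.\<close>

lemma fin_path_iff_pad:
  assumes "first_sink \<pi>"
  shows "\<pi> \<in> fin_paths (model \<sigma> P) \<longleftrightarrow> pad \<pi> \<in> inf_paths (model \<sigma> P)"
proof -
  have "(\<forall>i. Suc i < length \<pi> \<longrightarrow> step (\<pi> ! i) (\<pi> ! Suc i)) \<longleftrightarrow> steps (pad \<pi>)"
    using assms
  proof (induction \<pi>)
    case (Cons c \<pi>)
    show ?case
    proof (cases "\<pi> = []")
      case True
      then show ?thesis using Cons.prems by (simp add: steps_Sink split: if_splits)
    next
      case False
      then have "first_sink \<pi>" using Cons.prems by (simp split: if_splits)
      moreover have "(\<forall>i. Suc i < length (c # \<pi>) \<longrightarrow> step ((c # \<pi>) ! i) ((c # \<pi>) ! Suc i)) \<longleftrightarrow>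
          step c (\<pi> ! 0) \<and> (\<forall>i. Suc i < length \<pi> \<longrightarrow> step (\<pi> ! i) (\<pi> ! Suc i))"
        by (cases \<pi>) (use False in \<open>auto simp: All_less_Suc2\<close>)
      ultimately show ?thesis
        using Cons.IH False unfolding steps_pad_Cons by (simp add: pad_def[of _ 0])
    qed
  qed simp
  moreover have "\<pi> \<noteq> []" using assms by auto
  ultimately show ?thesis
    by (auto simp: fin_paths_model inf_paths_model pad_def hd_conv_nth)
qed

text \<open>The padded path is infinite and therefore follows a member of \<open>sink_paths\<close>;
  both stop at the same first \<open>Sink\<close>.\<close>

lemma fin_path_in_sink_paths:
  assumes "\<pi> \<in> fin_paths (model \<sigma> P)" "first_sink \<pi>"
  shows "\<pi> \<in> sink_paths \<sigma> P"
proof -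
  have "pad \<pi> \<in> inf_paths (model \<sigma> P)"
    using assms fin_path_iff_pad by blast
  then obtain \<rho> where \<rho>: "\<rho> \<in> sink_paths \<sigma> P" "follows (pad \<pi>) \<rho>"
    using sink_paths_cover[of "pad \<pi>" P \<sigma>] by (auto simp: inf_paths_model)
  then have "\<pi> = \<rho>"
    using first_sink_unique assms(2) first_sink_sink_paths follows_pad by blast
  then show ?thesis using \<rho> by simp
qed

text \<open>Serves numerator and denominator alike, with \<open>g\<close> the path reward or the
  constant 1.\<close>

lemma sum_path_prob:
  "(\<Sum>\<pi> \<in> {\<pi> \<in> fin_paths (model \<sigma> P). first_sink \<pi> \<and> Bad \<notin> set \<pi>}.
      path_prob (model \<sigma> P) S \<pi> * g \<pi>) =
    expect_run S \<sigma> P [] (\<lambda>\<rho>. if Bad \<in> set \<rho> then 0 else g \<rho>)"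
  unfolding expect_run_eq_sum
proof (rule sum.mono_neutral_cong_left)
  show "{\<pi> \<in> fin_paths (model \<sigma> P). first_sink \<pi> \<and> Bad \<notin> set \<pi>} \<subseteq> sink_paths \<sigma> P"
    using fin_path_in_sink_paths by blast
  \<comment> \<open>\<open>sink_paths\<close> keeps both branches of a coin flip even if
    \<open>p\<close> is 0 or 1. Its surplus members either meet \<open>Bad\<close> or are not paths
    of the model, and the latter have probability 0.\<close>
  show "\<forall>\<rho> \<in> sink_paths \<sigma> P - {\<pi> \<in> fin_paths (model \<sigma> P). first_sink \<pi> \<and> Bad \<notin> set \<pi>}.
      pmf (run S \<sigma> P []) \<rho> * (if Bad \<in> set \<rho> then 0 else g \<rho>) = 0"
    using pad_run_in_inf_paths fin_path_iff_pad first_sink_sink_paths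
    by (auto simp: set_pmf_iff)
qed (auto simp: path_prob_sink_path fin_path_in_sink_paths fin_paths_model)

lemma steps_from_Sink: "steps \<omega> \<Longrightarrow> \<omega> 0 = Sink \<Longrightarrow> \<omega> i = Sink"
  by (induction i) (metis step_Sink steps_def)+

text \<open>\<open>Sink\<close> is absorbing, so a path is determined once it arrives there: the
  cylinder of such a \<open>\<pi>\<close> has at most one element.\<close>

lemma eq_pad:
  assumes "first_sink \<pi>" "steps \<omega>" "follows \<omega> \<pi>"
  shows "\<omega> = pad \<pi>"
  using assms
proof (induction \<pi> arbitrary: \<omega>)
  case (Cons c \<pi>)
  show ?case
  proof (cases "c = Sink")
    case True
    then show ?thesis using Cons.prems steps_from_Sink by (auto simp: fun_eq_iff)
  next
    case False
    have "\<omega> (Suc i) = pad \<pi> i" for i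
      using Cons.IH[of "\<lambda>i. \<omega> (Suc i)"] Cons.prems False steps_unfold by (metis first_sink.simps(2) follows_Cons)
    then have "\<omega> i = pad (c # \<pi>) i" for i
      using Cons.prems(3) by (cases i) auto
    then show ?thesis by blast
  qed
qed simp

lemma exp_rew_model:
  "exp_rew (model \<sigma> P) S {Sink} {Bad} =
    expect_run S \<sigma> P [] (\<lambda>\<rho>. if Bad \<in> set \<rho> then 0 else path_reward (model \<sigma> P) \<rho>)"
proof -
  have "{\<pi> \<in> fin_paths (model \<sigma> P). last \<pi> \<in> {Sink} \<and> set (butlast \<pi>) \<inter> {Sink} = {} \<and>
      set \<pi> \<inter> {Bad} = {}} = {\<pi> \<in> fin_paths (model \<sigma> P). first_sink \<pi> \<and> Bad \<notin> set \<pi>}" (is "?A = ?B")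
    by (auto simp: first_sink_iff fin_paths_model)
  \<comment> \<open>Finiteness turns the infinite sum of \<open>exp_rew\<close> into an ordinary
    one.\<close>
  moreover have "finite ?B"
    using fin_path_in_sink_paths by (blast intro: finite_subset[OF _ finite_sink_paths])
  ultimately show ?thesis
    by (simp add: exp_rew_def sum_path_prob)
qed

section \<open>The path measure and the probability of avoiding \<open>Bad\<close>\<close>

lemma emeasure_cylinder:
  assumes "\<pi> \<in> fin_paths (model \<sigma> P)"
  shows "emeasure (path_measure (model \<sigma> P) S) (cylinder (model \<sigma> P) \<pi>) =
    ennreal (path_prob (model \<sigma> P) S \<pi>)"
proof (rule emeasure_extend_measure[OF path_measure_def])
  \<comment> \<open>\<open>extend_measure\<close> takes the prescribed values only if some measure
    has them, and is zero otherwise. The law of the padded run is such a measure; it is concentrated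
    on \<open>inf_paths\<close>.\<close>
  let ?M = "measure_pmf (map_pmf pad (run S \<sigma> P []))"
  show "emeasure ?M (cylinder (model \<sigma> P) \<pi>) = ennreal (path_prob (model \<sigma> P) S \<pi>)"
    if "\<pi> \<in> fin_paths (model \<sigma> P)" for \<pi>
  proof -
    have "emeasure ?M (cylinder (model \<sigma> P) \<pi>) =
        emeasure (run S \<sigma> P []) {\<rho>. pad \<rho> \<in> cylinder (model \<sigma> P) \<pi>}"
      by (simp add: vimage_def)
    also have "\<dots> = emeasure (run S \<sigma> P []) {\<rho>. follows (pad \<rho>) \<pi>}"
      using pad_run_in_inf_paths
      by (intro emeasure_eq_AE) (auto simp: AE_measure_pmf_iff cylinder_model)
    also have "\<dots> = ennreal (path_prob (model \<sigma> P) S \<pi>)"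
      using that by (simp add: measure_pmf.emeasure_eq_measure prob_follows_run fin_paths_model)
    finally show ?thesis .
  qed
  show "cylinder (model \<sigma> P) ` fin_paths (model \<sigma> P) \<subseteq> Pow (inf_paths (model \<sigma> P))"
    by (auto simp: cylinder_model)
  show "positive (sets (path_measure (model \<sigma> P) S)) (emeasure ?M)"
    by (simp add: positive_def)
  show "countably_additive (sets (path_measure (model \<sigma> P) S)) (emeasure ?M)"
    by (rule countably_additiveI) (rule suminf_emeasure, auto)
qed fact

lemma cylinder_sets: "\<pi> \<in> fin_paths (model \<sigma> P) \<Longrightarrow>
    cylinder (model \<sigma> P) \<pi> \<in> sets (path_measure (model \<sigma> P) S)"
  unfolding path_measure_def by (subst sets_extend_measure) (auto simp: cylinder_model)

text \<open>Every infinite path reaches \<open>Sink\<close>, so the event is a finite union of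
  cylinders of paths ending there, disjoint by \<open>first_sink_unique\<close>.\<close>

lemma prob_avoid_model:
  "prob_avoid (model \<sigma> P) S {Bad} =
    expect_run S \<sigma> P [] (\<lambda>\<rho>. if Bad \<in> set \<rho> then 0 else 1)"
proof -
  let ?M = "path_measure (model \<sigma> P) S"
  let ?B = "{\<pi> \<in> fin_paths (model \<sigma> P). first_sink \<pi> \<and> Bad \<notin> set \<pi>}"
  have fin: "finite ?B"
    using fin_path_in_sink_paths by (blast intro: finite_subset[OF _ finite_sink_paths])
  have "{\<omega> \<in> inf_paths (model \<sigma> P). \<forall>i. \<omega> i \<notin> {Bad}} =
      (\<Union>\<pi> \<in> ?B. cylinder (model \<sigma> P) \<pi>)" (is "?L = ?R")
  proof (intro subset_antisym subsetI)
    fix \<omega> assume \<omega>: "\<omega> \<in> ?L"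
    then obtain \<rho> where \<rho>: "\<rho> \<in> sink_paths \<sigma> P" "follows \<omega> \<rho>"
      using sink_paths_cover[of \<omega> P \<sigma>] by (auto simp: inf_paths_model)
    have fs: "first_sink \<rho>" using \<rho> first_sink_sink_paths by blast
    have "\<omega> = pad \<rho>" using \<omega> \<rho> fs eq_pad by (auto simp: inf_paths_model)
    then have "\<rho> \<in> fin_paths (model \<sigma> P)" using \<omega> fs fin_path_iff_pad by auto
    moreover have "Bad \<notin> set \<rho>"
      using \<omega> \<rho>(2) by (auto simp: follows_def in_set_conv_nth)
    ultimately show "\<omega> \<in> ?R" using \<omega> \<rho> fs by (auto simp: cylinder_model)
  next
    fix \<omega> assume "\<omega> \<in> ?R"
    then obtain \<pi> where \<pi>: "first_sink \<pi>" "Bad \<notin> set \<pi>" "\<omega> \<in> inf_paths (model \<sigma> P)" "follows \<omega> \<pi>"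
      by (auto simp: cylinder_model)
    then have "\<omega> = pad \<pi>" using eq_pad by (auto simp: inf_paths_model)
    then have "\<omega> i \<noteq> Bad" for i using \<pi>(2) by (metis config.distinct(11) nth_mem pad_def)
    then show "\<omega> \<in> ?L" using \<pi>(3) by auto
  qed
  then have "prob_avoid (model \<sigma> P) S {Bad} = measure ?M ?R"
    by (simp add: prob_avoid_def)
  also have "\<dots> = (\<Sum>\<pi> \<in> ?B. measure ?M (cylinder (model \<sigma> P) \<pi>))"
  proof (rule measure_finite_Union)
    show "disjoint_family_on (cylinder (model \<sigma> P)) ?B"
      using first_sink_unique by (fastforce simp: disjoint_family_on_def cylinder_model)
  qed (use fin cylinder_sets in \<open>auto simp: emeasure_cylinder\<close>)
  also have "\<dots> = (\<Sum>\<pi> \<in> ?B. path_prob (model \<sigma> P) S \<pi> * 1)"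
    by (intro sum.cong) (auto simp: measure_def emeasure_cylinder path_prob_def prod_nonneg)
  also have "\<dots> = expect_run S \<sigma> P [] (\<lambda>\<rho>. if Bad \<in> set \<rho> then 0 else 1)"
    by (rule sum_path_prob)
  finally show ?thesis .
qed

section \<open>Conditional rewards and their infimum over schedulers\<close>

definition ok_reward :: "('e, 'g) config list \<Rightarrow> real" where
  "ok_reward \<rho> = (if Bad \<in> set \<rho> then 0 else sum_list (map prog_reward (butlast \<rho>)))"

definition ok :: "('e, 'g) config list \<Rightarrow> real" where
  "ok \<rho> = (if Bad \<in> set \<rho> then 0 else 1)"

text \<open>\<open>Run\<close> configurations earn nothing and are not \<open>Bad\<close>, so the
  integrand passes unchanged to subprograms.\<close>

lemma ok_reward_Run [simp]: "ok_reward (Run P \<sigma> # \<rho>) = ok_reward \<rho>"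
  by (simp add: ok_reward_def)

lemma ok_Run [simp]: "ok (Run P \<sigma> # \<rho>) = ok \<rho>"
  by (simp add: ok_def)

lemma ok_last [simp]:
  "ok_reward [Term \<sigma>, Sink] = real_of_nonneg \<sigma>" "ok [Term \<sigma>, Sink] = 1"
  "ok_reward [Bad, Sink] = 0" "ok [Bad, Sink] = 0"
  by (simp_all add: ok_reward_def ok_def)

definition cond_reward ::
  "(('e, 'g) config list \<Rightarrow> action) \<Rightarrow> nonneg_real \<Rightarrow> ('e, 'g) prog \<Rightarrow> real option" where
  "cond_reward S \<sigma> P = quotient (expect_run S \<sigma> P [] ok_reward) (expect_run S \<sigma> P [] ok)"

lemma cexp_rew_model:
  "cexp_rew (model \<sigma> P) {Sink} {Bad} =
     Inf_bot ((\<lambda>S. cond_reward S \<sigma> P) ` schedulers (model \<sigma> P))"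
proof -
  have "ok_reward = (\<lambda>\<rho>. if Bad \<in> set \<rho> then 0 else path_reward (model \<sigma> P) \<rho>)"
    "ok = (\<lambda>\<rho>. if Bad \<in> set \<rho> then 0 else 1)"
    by (auto simp: fun_eq_iff ok_reward_def ok_def path_reward_def prog_rmdp_def)
  then show ?thesis
    unfolding cexp_rew_def cond_reward_def exp_rew_model prob_avoid_model by simp
qed

lemma GoLeft_enabled: "GoLeft \<in> prog_enabled c"
  by (cases c rule: prog_enabled.cases) auto

text \<open>Prefers \<open>a\<close> wherever it is enabled. It shows that schedulers exist and
  realises either answer at a non-deterministic choice.\<close>

lemma sched_toward:
  "(\<lambda>\<pi>. if a \<in> prog_enabled (last \<pi>) then a else GoLeft) \<in> schedulers (model \<sigma> P)"
  by (simp add: schedulers_def prog_rmdp_def GoLeft_enabled)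

lemma cexp_rew_const:
  assumes "\<And>S. cond_reward S \<sigma> P = Some v"
  shows "cexp_rew (model \<sigma> P) {Sink} {Bad} = Some v"
proof -
  have "(\<lambda>S. cond_reward S \<sigma> P) ` schedulers (model \<sigma> P) = {Some v}"
    using sched_toward assms by auto
  then show ?thesis by (simp add: cexp_rew_model Inf_bot_def)
qed

text \<open>The scheduler matters only through its answer at the history \<open>\<pi>\<close>. Both
  answers occur, since \<open>\<pi>\<close> ends in a non-deterministic choice, so the infimum runs
  over two values.\<close>

lemma cexp_rew_choice:
  assumes v: "\<And>S. cond_reward S \<sigma> P = Some (if S \<pi> = GoLeft then v else w)"
    and \<pi>: "last \<pi> = Run (NChoice Q R) \<tau>"
  shows "cexp_rew (model \<sigma> P) {Sink} {Bad} = Some (min v w)"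
proof -
  let ?f = "\<lambda>S. cond_reward S \<sigma> P"
  have "Some v \<in> ?f ` schedulers (model \<sigma> P)"
    by (rule image_eqI[OF _ sched_toward[of GoLeft]]) (simp add: v \<pi>)
  moreover have "Some w \<in> ?f ` schedulers (model \<sigma> P)"
    by (rule image_eqI[OF _ sched_toward[of GoRight]]) (simp add: v \<pi>)
  ultimately have "?f ` schedulers (model \<sigma> P) = {Some v, Some w}"
    by (auto simp: v)
  moreover have "{x. Some x \<in> {Some v, Some w}} = {v, w}" by auto
  ultimately show ?thesis by (simp add: cexp_rew_model Inf_bot_def cInf_eq_Min)
qed

end

section \<open>The counterexample\<close>

theorem mainTheorem5:
  fixes aval :: "'e \<Rightarrow> nonneg_real \<Rightarrow> nonneg_real"
    and bval :: "'g \<Rightarrow> nonneg_real \<Rightarrow> bool"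
    and \<sigma>\<^sub>0 :: nonneg_real
  assumes rational_constants:
      "\<And>q :: rat. 0 \<le> q \<Longrightarrow> \<exists>E. \<forall>\<sigma>. real_of_nonneg (aval E \<sigma>) = of_rat q"
    and false_guard: "\<exists>G. \<forall>\<sigma>. \<not> bval G \<sigma>"
  shows "\<not> (\<exists>(D :: 'd set) (interp :: 'd \<Rightarrow> real option) (cwp :: ('e, 'g) prog \<Rightarrow> 'd).
            inductive_CPET aval bval \<sigma>\<^sub>0 D interp cwp)"
proof (intro notI, elim exE)
  fix D :: "'d set" and interp :: "'d \<Rightarrow> real option" and cwp :: "('e, 'g) prog \<Rightarrow> 'd"
  assume "inductive_CPET aval bval \<sigma>\<^sub>0 D interp cwp"
  then obtain K N where D: "\<And>P. cwp P \<in> D"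
    and interp: "\<And>P. interp (cwp P) = cexp_rew (prog_rmdp aval bval \<sigma>\<^sub>0 P) {Sink} {Bad}"
    and K: "\<And>P p Q. cwp (PChoice P p Q) = K (cwp P) p (cwp Q)"
    and N: "\<And>d d'. d \<in> D \<Longrightarrow> d' \<in> D \<Longrightarrow> N d d' \<in> {d, d'}"
      "\<And>P Q. cwp (NChoice P Q) = N (cwp P) (cwp Q)"
    unfolding inductive_CPET_def by blast
  obtain G where G: "\<And>\<sigma>. \<not> bval G \<sigma>" using false_guard by blast
  obtain E0 E4 E5 where E: "\<And>\<sigma>. real_of_nonneg (aval E0 \<sigma>) = 0"
    "\<And>\<sigma>. real_of_nonneg (aval E4 \<sigma>) = 4" "\<And>\<sigma>. real_of_nonneg (aval E5 \<sigma>) = 5"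
    using rational_constants[of 0] rational_constants[of 4] rational_constants[of 5] by auto
  define half where "half = Abs_unit (1/2)"
  have half: "real_of_unit half = 1/2" by (simp add: half_def Abs_unit_inverse)
  define A B C where "A = (Assign E0 :: ('e, 'g) prog)" and "B = (Assign E4 :: ('e, 'g) prog)"
    and "C = PChoice (Observe G) half (Assign E5)"
  note defs = A_def B_def C_def
  \<comment> \<open>\<open>run.simps(3)\<close> is disabled in the computations below so that
    \<open>expect_run_PChoice\<close> evaluates the coin flips.\<close>
  note compute = cond_reward_def quotient_def expect_run_PChoice half E G defs
  have "interp (cwp B) = Some 4"
    unfolding interp by (rule cexp_rew_const) (simp add: compute del: run.simps(3))
  moreover have "interp (cwp C) = Some 5"
    unfolding interp by (rule cexp_rew_const) (simp add: compute del: run.simps(3))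
  moreover have "interp (cwp (NChoice B C)) = Some (min 4 5)"
    unfolding interp
    by (rule cexp_rew_choice[where \<pi> = "[Run (NChoice B C) \<sigma>\<^sub>0]"])
       (auto simp: compute simp del: run.simps(3) split: action.splits)
  \<comment> \<open>\<open>N\<close> returns \<open>cwp B\<close> or \<open>cwp C\<close>; the
    latter is excluded because its interpretation is 5, not 4.\<close>
  ultimately have "cwp (NChoice B C) = cwp B"
    using N(1)[OF D D, of B C] N(2)[of B C] by auto
  then have "cwp (PChoice A half (NChoice B C)) = cwp (PChoice A half B)"
    by (simp add: K)
  moreover have "interp (cwp (PChoice A half B)) = Some 2"
    unfolding interp by (rule cexp_rew_const) (simp add: compute del: run.simps(3))
  \<comment> \<open>The choice is reached only after the coin has gone right, so the deciding
    history consists of the outer configuration and the choice itself.\<close>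
  moreover have "interp (cwp (PChoice A half (NChoice B C))) = Some (min 2 (5/3))"
    unfolding interp
    by (rule cexp_rew_choice[where \<pi> =
          "[Run (PChoice A half (NChoice B C)) \<sigma>\<^sub>0, Run (NChoice B C) \<sigma>\<^sub>0]"])
       (auto simp: compute simp del: run.simps(3) split: action.splits)
  ultimately show False by simp
qed

end
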